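(* Let $\rho:\mathrm{QSym}\to\mathrm{QSym}$ be the linear map with $\rho(F_\alpha)=F_{\alpha^r}$ for every composition $\alpha$. Then $\rho$ is the unique nontrivial (i.e. non-identity) graded algebra automorphism of $\mathrm{QSym}$ that takes the monomial basis $\{M_\alpha:\alpha\in\mathcal{C}\}$ onto itself.
   Context: A composition is a finite (possibly empty) ordered list $\alpha=(\alpha_1,\dots,\alpha_k)$ of positive integers; $|\alpha|=\alpha_1+\cdots+\alpha_k$, and $\mathcal{C}$ is the set of all compositions ($\emptyset$ is the empty one). The reversal $\alpha^r$ is $(\alpha_k,\dots,\alpha_1)$. $\mathrm{QSym}$ is the set of bounded-degree formal power series $f\in\mathbb{Q}[[x_1,x_2,\dots]]$ such that for each composition $(\alpha_1,\dots,\alpha_k)$ all monomials $x_{i_1}^{\alpha_1}\cdots x_{i_k}^{\alpha_k}$ with $i_1<\cdots<i_k$ have the same coefficient in $f$; it is a graded subalgebra of the power series algebra. The monomial basis is $M_\emptyset=1$, $M_\alpha=\sum_{i_1<\cdots<i_k}x_{i_1}^{\alpha_1}\cdots x_{i_k}^{\alpha_k}$. Write $\beta\preceq\alpha$ if $\alpha$ is obtained from $\beta$ by summing some consecutive parts of $\beta$. The fundamental basis is $F_\emptyset=1$, $F_\alpha=\sum_{\beta\preceq\alpha}M_\beta$. $\mathrm{QSym}=\bigoplus_{n\ge0}\mathrm{QSym}_n$ with $\mathrm{QSym}_n=\mathrm{span}\{M_\alpha:|\alpha|=n\}=\mathrm{span}\{F_\alpha:|\alpha|=n\}$. A map is graded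 if it maps $\mathrm{QSym}_n$ into $\mathrm{QSym}_n$ for all $n$. *)

theory Defs
  imports Complex_Main "HOL-Library.Poly_Mapping"
begin

section \<open>Compositions\<close>

typedef composition = "{\<alpha> :: nat list. 0 \<notin> set \<alpha>}"
  morphisms parts Composition
  by (rule exI[of _ "[]"]) simp

setup_lifting type_definition_composition

lift_definition csize :: "composition \<Rightarrow> nat" is sum_list .

lift_definition crev :: "composition \<Rightarrow> composition" is rev by simp

text \<open>\<open>refines \<beta> \<alpha>\<close> is the relation \<open>\<beta> \<preceq> \<alpha>\<close>: cut \<open>\<beta>\<close> into nonempty
  consecutive blocks; the block sums are the parts of \<open>\<alpha>\<close>.\<close>

definition refines :: "composition \<Rightarrow> composition \<Rightarrow> bool" where
  "refines \<beta> \<alpha> \<longleftrightarrow>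
     (\<exists>bs. [] \<notin> set bs \<and> concat bs = parts \<beta> \<and> map sum_list bs = parts \<alpha>)"

lemma csize_eq_if_refines: "refines \<beta> \<alpha> \<Longrightarrow> csize \<beta> = csize \<alpha>"
proof -
  have "sum_list (concat bs) = sum_list (map sum_list bs)" for bs :: "nat list list"
    by (induction bs) auto
  thus "refines \<beta> \<alpha> \<Longrightarrow> csize \<beta> = csize \<alpha>"
    unfolding refines_def csize.rep_eq by metis
qed

lemma finite_csize: "finite {\<alpha>. csize \<alpha> = n}"
proof (rule finite_imageD)
  have len: "0 \<notin> set xs \<Longrightarrow> length xs \<le> sum_list xs" for xs :: "nat list"
    by (induction xs) auto
  have "parts ` {\<alpha>. csize \<alpha> = n} \<subseteq> {xs. set xs \<subseteq> {..n} \<and> length xs \<le> n}"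
    using parts len by (auto simp: csize.rep_eq intro: member_le_sum_list)
  thus "finite (parts ` {\<alpha>. csize \<alpha> = n})"
    by (rule finite_subset) (simp add: finite_lists_length_le)
  show "inj_on parts {\<alpha>. csize \<alpha> = n}"
    by (simp add: inj_on_def parts_inject)
qed

lemma finite_refines: "finite {\<beta>. refines \<beta> \<alpha>}"
  by (rule finite_subset[OF _ finite_csize[of "csize \<alpha>"]]) (auto simp: csize_eq_if_refines)

section \<open>Formal power series over the rationals in countably many variables\<close>

text \<open>The variables are indexed by \<open>0, 1, 2, \<dots>\<close> (instead of \<open>1, 2, 3, \<dots>\<close>), and a monomial is its
  finitely supported exponent vector.\<close>

type_synonym monomial = "nat \<Rightarrow>\<^sub>0 nat"

definition mdegree :: "monomial \<Rightarrow> nat" where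
  "mdegree m = (\<Sum>i\<in>Poly_Mapping.keys m. Poly_Mapping.lookup m i)"

typedef pseries = "UNIV :: (monomial \<Rightarrow> rat) set"
  morphisms coeff PSeries ..

setup_lifting type_definition_pseries

lemma pseries_eqI: "(\<And>m. coeff f m = coeff g m) \<Longrightarrow> f = g"
  by (metis coeff_inject ext)

definition decomps :: "monomial \<Rightarrow> (monomial \<times> monomial) set" where
  "decomps m = {(a, b). a + b = m}"

lemma finite_decomps [simp]: "finite (decomps m)"
proof -
  let ?K = "Poly_Mapping.keys m"
  let ?B = "{f. \<forall>i. (i \<in> ?K \<longrightarrow> f i \<in> {..mdegree m}) \<and> (i \<notin> ?K \<longrightarrow> f i = 0)}"
  have fin: "finite ?B"
    by (rule finite_set_of_finite_funs) auto
  have le: "Poly_Mapping.lookup m i \<le> mdegree m" if "i \<in> ?K" for i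
    unfolding mdegree_def by (rule member_le_sum) (use that in auto)
  have "Poly_Mapping.lookup a \<in> ?B" if "a + b = m" for a b
  proof -
    have l: "Poly_Mapping.lookup a i \<le> Poly_Mapping.lookup m i" for i
      using that by (auto simp: lookup_add)
    show ?thesis
      using l le by (auto simp: in_keys_iff intro: order.trans) (metis le_zero_eq)
  qed
  hence "Poly_Mapping.lookup ` fst ` decomps m \<subseteq> ?B"
    by (auto simp: decomps_def)
  hence "finite (Poly_Mapping.lookup ` fst ` decomps m)"
    using fin by (rule finite_subset)
  hence "finite (fst ` decomps m)"
    by (rule finite_imageD) (simp add: inj_on_def lookup_inject)
  thus ?thesis
    by (rule finite_imageD) (auto simp: inj_on_def decomps_def)
qed

instantiation pseries :: comm_ring_1
begin

lift_definition zero_pseries :: pseries is "\<lambda>_. 0" .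
lift_definition one_pseries :: pseries is "\<lambda>m. if m = 0 then 1 else 0" .
lift_definition plus_pseries :: "pseries \<Rightarrow> pseries \<Rightarrow> pseries" is "\<lambda>f g m. f m + g m" .
lift_definition uminus_pseries :: "pseries \<Rightarrow> pseries" is "\<lambda>f m. - f m" .
lift_definition minus_pseries :: "pseries \<Rightarrow> pseries \<Rightarrow> pseries" is "\<lambda>f g m. f m - g m" .
lift_definition times_pseries :: "pseries \<Rightarrow> pseries \<Rightarrow> pseries" is
  "\<lambda>f g m. \<Sum>(a, b)\<in>decomps m. f a * g b" .

instance proof
  fix f g h :: pseries
  show "f + g + h = f + (g + h)" by transfer auto
  show "f + g = g + f" by transfer auto
  show "0 + f = f" by transfer auto
  show "- f + f = 0" by transfer auto
  show "f - g = f + - g" by transfer auto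
  show "(0::pseries) \<noteq> 1" by transfer (metis zero_neq_one)
  show "f * g = g * f"
    by (transfer, rule ext, rule sum.reindex_bij_witness[of _ prod.swap prod.swap])
       (auto simp: decomps_def add.commute mult.commute)
  show "(f + g) * h = f * h + g * h"
    by transfer (auto simp: sum.distrib[symmetric] algebra_simps intro!: sum.cong)
  show "1 * f = f"
  proof (transfer, rule ext)
    fix f :: "monomial \<Rightarrow> rat" and m
    have "(\<Sum>(a, b)\<in>decomps m. (if a = 0 then 1 else 0) * f b) =
          (\<Sum>(a, b)\<in>{(0::monomial, m)}. (if a = 0 then 1 else 0) * f b)"
      by (rule sum.mono_neutral_right) (simp_all, auto simp: decomps_def split: if_splits)
    thus "(\<Sum>(a, b)\<in>decomps m. (if a = 0 then 1 else 0) * f b) = f m" by simp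
  qed
  show "f * g * h = f * (g * h)"
  proof (transfer, rule ext)
    fix f g h :: "monomial \<Rightarrow> rat" and m
    have "(\<Sum>(a, b)\<in>decomps m. (\<Sum>(c, d)\<in>decomps a. f c * g d) * h b) =
          (\<Sum>p\<in>decomps m. \<Sum>q\<in>decomps (fst p). f (fst q) * g (snd q) * h (snd p))"
      by (simp add: case_prod_beta sum_distrib_right)
    also have "\<dots> = (\<Sum>(p, q)\<in>(SIGMA p:decomps m. decomps (fst p)).
                       f (fst q) * g (snd q) * h (snd p))"
      by (rule sum.Sigma) auto
    also have "\<dots> = (\<Sum>(p, q)\<in>(SIGMA p:decomps m. decomps (snd p)).
                       f (fst p) * (g (fst q) * h (snd q)))"
      by (rule sum.reindex_bij_witness[of _
            "\<lambda>((a, b), (c, d)). ((a + c, d), (a, c))" "\<lambda>((a, b), (c, d)). ((c, d + b), (d, b))"])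
         (auto simp: decomps_def add.assoc mult.assoc)
    also have "\<dots> = (\<Sum>p\<in>decomps m. \<Sum>q\<in>decomps (snd p). f (fst p) * (g (fst q) * h (snd q)))"
      by (rule sum.Sigma[symmetric]) auto
    also have "\<dots> = (\<Sum>(a, b)\<in>decomps m. f a * (\<Sum>(c, d)\<in>decomps b. g c * h d))"
      by (simp add: case_prod_beta sum_distrib_left)
    finally show "(\<Sum>(a, b)\<in>decomps m. (\<Sum>(c, d)\<in>decomps a. f c * g d) * h b) =
                  (\<Sum>(a, b)\<in>decomps m. f a * (\<Sum>(c, d)\<in>decomps b. g c * h d))" .
  qed
qed

end

section \<open>Quasisymmetric functions\<close>

text \<open>\<open>vmonom is as\<close> is the product of the powers with variable index \<open>is ! j\<close> and
  exponent \<open>as ! j\<close>.\<close>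

definition vmonom :: "nat list \<Rightarrow> nat list \<Rightarrow> monomial" where
  "vmonom is as = (\<Sum>(i, a)\<leftarrow>zip is as. Poly_Mapping.single i a)"

definition quasisymmetric :: "pseries \<Rightarrow> bool" where
  "quasisymmetric f \<longleftrightarrow>
     (\<exists>d. \<forall>m. coeff f m \<noteq> 0 \<longrightarrow> mdegree m \<le> d) \<and>
     (\<forall>\<alpha> is js. length is = length (parts \<alpha>) \<and> sorted_wrt (<) is \<and>
                 length js = length (parts \<alpha>) \<and> sorted_wrt (<) js \<longrightarrow>
                 coeff f (vmonom is (parts \<alpha>)) = coeff f (vmonom js (parts \<alpha>)))"

lemma mdegree_superset:
  assumes "finite A" "Poly_Mapping.keys m \<subseteq> A"
  shows "mdegree m = (\<Sum>i\<in>A. Poly_Mapping.lookup m i)"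
  unfolding mdegree_def by (rule sum.mono_neutral_left) (use assms in \<open>auto simp: in_keys_iff\<close>)

lemma mdegree_0 [simp]: "mdegree 0 = 0"
  by (simp add: mdegree_def)

lemma mdegree_add: "mdegree (a + b) = mdegree a + mdegree b"
proof -
  let ?A = "Poly_Mapping.keys a \<union> Poly_Mapping.keys b"
  have "mdegree (a + b) = (\<Sum>i\<in>?A. Poly_Mapping.lookup (a + b) i)"
    by (rule mdegree_superset) (use Poly_Mapping.keys_add[of a b] in auto)
  also have "\<dots> = mdegree a + mdegree b"
    using mdegree_superset[of ?A a] mdegree_superset[of ?A b] by (simp add: lookup_add sum.distrib)
  finally show ?thesis .
qed

lemma mdegree_single: "mdegree (Poly_Mapping.single i n) = n"
  by (simp add: mdegree_def)

lemma mdegree_vmonom: "length is = length as \<Longrightarrow> mdegree (vmonom is as) = sum_list as"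
  by (induction "is" as rule: list_induct2) (auto simp: vmonom_def mdegree_add mdegree_single)

lemma lookup_vmonom_map:
  "distinct is \<Longrightarrow> Poly_Mapping.lookup (vmonom is (map f is)) i = (if i \<in> set is then f i else 0)"
  by (induction "is") (auto simp: vmonom_def lookup_add lookup_single when_def)

lemma lookup_vmonom_notin: "i \<notin> set is \<Longrightarrow> Poly_Mapping.lookup (vmonom is as) i = 0"
proof (induction "is" arbitrary: as)
  case (Cons x xs)
  thus ?case by (cases as) (auto simp: vmonom_def lookup_add lookup_single when_def)
qed (simp add: vmonom_def)

lemma map_lookup_vmonom:
  "length is = length as \<Longrightarrow> distinct is \<Longrightarrow> map (Poly_Mapping.lookup (vmonom is as)) is = as"
proof (induction "is" as rule: list_induct2)
  case (Cons x xs y ys)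
  have eq: "vmonom (x # xs) (y # ys) = Poly_Mapping.single x y + vmonom xs ys"
    by (simp add: vmonom_def)
  have "map (Poly_Mapping.lookup (vmonom (x # xs) (y # ys))) xs = map (Poly_Mapping.lookup (vmonom xs ys)) xs"
    using Cons.prems by (auto simp: eq lookup_add lookup_single when_def)
  moreover have "Poly_Mapping.lookup (vmonom (x # xs) (y # ys)) x = y"
    using Cons.prems by (simp add: eq lookup_add lookup_vmonom_notin)
  ultimately show ?case using Cons.IH Cons.prems by (simp del: map_eq_conv)
qed simp

lemma vmonom_map_lookup:
  "distinct is \<Longrightarrow> Poly_Mapping.keys c \<subseteq> set is \<Longrightarrow> vmonom is (map (Poly_Mapping.lookup c) is) = c"
  by (rule poly_mapping_eqI) (auto simp: lookup_vmonom_map in_keys_iff)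

lemma vmonom_filter:
  "vmonom is as = vmonom (map fst (filter (\<lambda>p. snd p \<noteq> 0) (zip is as)))
                     (map snd (filter (\<lambda>p. snd p \<noteq> 0) (zip is as)))"
proof (induction "is" arbitrary: as)
  case (Cons x xs)
  thus ?case by (cases as) (auto simp: vmonom_def)
qed (simp add: vmonom_def)

lemma filter_zip_snd:
  "length is = length as \<Longrightarrow> map snd (filter (\<lambda>p. snd p \<noteq> 0) (zip is as)) = filter (\<lambda>a. a \<noteq> 0) as"
  by (induction "is" as rule: list_induct2) auto

lemma filter_zip_sorted:
  "length is = length as \<Longrightarrow> sorted_wrt (<) (is :: nat list) \<Longrightarrow>
     sorted_wrt (<) (map fst (filter (\<lambda>p. snd p \<noteq> 0) (zip is as)))"
  by (induction "is" as rule: list_induct2) (auto dest: set_zip_leftD)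

lemma quasisymmetric_weak:
  assumes "quasisymmetric f"
    and "length is = length as" "sorted_wrt (<) is" "length js = length as" "sorted_wrt (<) js"
  shows "coeff f (vmonom is as) = coeff f (vmonom js as)"
proof -
  define as' where "as' = filter (\<lambda>a. a \<noteq> 0) as"
  have p: "parts (Composition as') = as'"
    by (rule Composition_inverse) (simp add: as'_def)
  define red where "red ks = map fst (filter (\<lambda>p. snd p \<noteq> 0) (zip ks as))" for ks :: "nat list"
  have red: "vmonom ks as = vmonom (red ks) (parts (Composition as'))"
    "length (red ks) = length (parts (Composition as'))" "sorted_wrt (<) (red ks)"
    if "length ks = length as" "sorted_wrt (<) ks" for ks
  proof -
    have snd: "map snd (filter (\<lambda>p. snd p \<noteq> 0) (zip ks as)) = as'"
      using filter_zip_snd[OF that(1)] by (simp add: as'_def)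
    show "vmonom ks as = vmonom (red ks) (parts (Composition as'))"
      using vmonom_filter[of ks as] by (simp only: red_def p snd)
    show "length (red ks) = length (parts (Composition as'))"
      using arg_cong[OF snd, of length] by (simp add: red_def p)
    show "sorted_wrt (<) (red ks)"
      using filter_zip_sorted[OF that] by (simp add: red_def)
  qed
  have "coeff f (vmonom (red is) (parts (Composition as'))) =
        coeff f (vmonom (red js) (parts (Composition as')))"
    using assms(1) red(2,3)[OF assms(2,3)] red(2,3)[OF assms(4,5)]
    unfolding quasisymmetric_def by blast
  thus ?thesis using red(1)[OF assms(2,3)] red(1)[OF assms(4,5)] by simp
qed

lemma coeff_mult_vmonom:
  assumes len: "length is = length as" and sorted: "sorted_wrt (<) is"
  shows "coeff (f * g) (vmonom is as) =
    (\<Sum>cs | length cs = length as \<and> list_all2 (\<le>) cs as.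
       coeff f (vmonom is cs) * coeff g (vmonom is (map2 (-) as cs)))"
proof -
  have dist: "distinct is" using sorted by (simp add: strict_sorted_iff)
  define m where "m = vmonom is as"
  have as: "as = map (Poly_Mapping.lookup m) is"
    using map_lookup_vmonom[OF len dist] by (simp add: m_def)
  have keys: "Poly_Mapping.keys m \<subseteq> set is"
    unfolding m_def by (metis in_keys_iff lookup_vmonom_notin subsetI)
  have sub: "Poly_Mapping.keys a \<subseteq> set is" "Poly_Mapping.keys b \<subseteq> set is" if "a + b = m" for a b
    using keys that by (auto simp: in_keys_iff lookup_add subset_iff)
  have b: "map2 (-) as (map (Poly_Mapping.lookup a) is) = map (Poly_Mapping.lookup b) is"
    if "a + b = m" for a b
    unfolding as that[symmetric] by (rule nth_equalityI) (auto simp: lookup_add)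
  have add: "vmonom is cs + vmonom is (map2 (-) as cs) = m"
    if "length cs = length as" "list_all2 (\<le>) cs as" for cs
  proof -
    have "length is = length cs \<Longrightarrow> length cs = length as \<Longrightarrow> list_all2 (\<le>) cs as \<Longrightarrow>
       vmonom is cs + vmonom is (map2 (-) as cs) = vmonom is as" for "is" :: "nat list"
    proof (induction "is" cs as rule: list_induct3)
      case (Cons x xs y ys z zs)
      have "Poly_Mapping.single x y + Poly_Mapping.single x (z - y) = Poly_Mapping.single x z"
        using Cons.prems by (simp add: single_add[symmetric])
      moreover have "vmonom xs ys + vmonom xs (map2 (-) zs ys) = vmonom xs zs"
        using Cons by simp
      moreover have "vmonom (x # xs) (y # ys) + vmonom (x # xs) (map2 (-) (z # zs) (y # ys)) =
          (Poly_Mapping.single x y + Poly_Mapping.single x (z - y)) +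
          (vmonom xs ys + vmonom xs (map2 (-) zs ys))"
        by (simp add: vmonom_def ac_simps)
      ultimately show ?case by (simp add: vmonom_def)
    qed (simp add: vmonom_def)
    thus ?thesis using that len by (simp add: m_def)
  qed
  have "coeff (f * g) m = (\<Sum>(a, b)\<in>decomps m. coeff f a * coeff g b)"
    by (simp add: times_pseries.rep_eq)
  also have "\<dots> = (\<Sum>cs | length cs = length as \<and> list_all2 (\<le>) cs as.
       coeff f (vmonom is cs) * coeff g (vmonom is (map2 (-) as cs)))"
  proof (rule sum.reindex_bij_witness[of _ "\<lambda>cs. (vmonom is cs, vmonom is (map2 (-) as cs))"
            "\<lambda>(a, b). map (Poly_Mapping.lookup a) is"], goal_cases)
    case (1 p)
    thus ?case
      by (auto simp: decomps_def b vmonom_map_lookup[OF dist] sub)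
  next
    case (2 p)
    have "list_all2 (\<le>) (map (Poly_Mapping.lookup a) is) as" if "a + b = m" for a b
      unfolding as that[symmetric] by (auto simp: list_all2_conv_all_nth lookup_add)
    thus ?case using 2 len by (auto simp: decomps_def)
  next
    case (3 cs)
    thus ?case using map_lookup_vmonom[of "is" cs] len dist by auto
  next
    case (4 cs)
    thus ?case using add by (auto simp: decomps_def)
  next
    case (5 p)
    thus ?case by (auto simp: decomps_def b vmonom_map_lookup[OF dist] sub)
  qed
  finally show ?thesis by (simp add: m_def)
qed

lemma quasisymmetricI:
  assumes "\<And>m. coeff f m \<noteq> 0 \<Longrightarrow> mdegree m \<le> d"
    and "\<And>\<alpha> is js. length is = length (parts \<alpha>) \<Longrightarrow> sorted_wrt (<) is \<Longrightarrow>
           length js = length (parts \<alpha>) \<Longrightarrow> sorted_wrt (<) js \<Longrightarrow>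
           coeff f (vmonom is (parts \<alpha>)) = coeff f (vmonom js (parts \<alpha>))"
  shows "quasisymmetric f"
  unfolding quasisymmetric_def using assms by blast

lemma quasisymmetric_bound:
  assumes "quasisymmetric f"
  shows "\<exists>d. \<forall>m. coeff f m \<noteq> 0 \<longrightarrow> mdegree m \<le> d"
  using assms unfolding quasisymmetric_def by (rule conjunct1)

lemma quasisymmetric_mult:
  assumes f: "quasisymmetric f" and g: "quasisymmetric g"
  shows "quasisymmetric (f * g)"
proof -
  obtain d where d: "\<forall>m. coeff f m \<noteq> 0 \<longrightarrow> mdegree m \<le> d"
    using quasisymmetric_bound[OF f] ..
  obtain e where e: "\<forall>m. coeff g m \<noteq> 0 \<longrightarrow> mdegree m \<le> e"
    using quasisymmetric_bound[OF g] ..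
  show ?thesis
  proof (rule quasisymmetricI)
    show "mdegree m \<le> d + e" if "coeff (f * g) m \<noteq> 0" for m
    proof -
      have "(\<Sum>p\<in>decomps m. coeff f (fst p) * coeff g (snd p)) \<noteq> 0"
        using that by (simp add: times_pseries.rep_eq case_prod_beta)
      then obtain p where "p \<in> decomps m" "coeff f (fst p) * coeff g (snd p) \<noteq> 0"
        by (rule sum.not_neutral_contains_not_neutral)
      thus ?thesis using d[rule_format, of "fst p"] e[rule_format, of "snd p"]
        by (auto simp: decomps_def mdegree_add)
    qed
  next
    fix \<alpha> and "is" js :: "nat list"
    assume *: "length is = length (parts \<alpha>)" "sorted_wrt (<) is"
      "length js = length (parts \<alpha>)" "sorted_wrt (<) js"
    show "coeff (f * g) (vmonom is (parts \<alpha>)) = coeff (f * g) (vmonom js (parts \<alpha>))"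
      unfolding coeff_mult_vmonom[OF *(1,2)] coeff_mult_vmonom[OF *(3,4)]
    proof (rule sum.cong[OF refl], clarify)
      fix cs :: "nat list" assume len: "length cs = length (parts \<alpha>)"
      have "coeff f (vmonom is cs) = coeff f (vmonom js cs)"
        by (rule quasisymmetric_weak[OF f]) (use * len in auto)
      moreover have "coeff g (vmonom is (map2 (-) (parts \<alpha>) cs)) =
                     coeff g (vmonom js (map2 (-) (parts \<alpha>) cs))"
        by (rule quasisymmetric_weak[OF g]) (use * len in auto)
      ultimately show "coeff f (vmonom is cs) * coeff g (vmonom is (map2 (-) (parts \<alpha>) cs)) =
            coeff f (vmonom js cs) * coeff g (vmonom js (map2 (-) (parts \<alpha>) cs))"
        by simp
    qed
  qed
qed

lemma quasisymmetric_0: "quasisymmetric 0"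
  by (simp add: quasisymmetric_def zero_pseries.rep_eq)

lemma vmonom_eq_0_iff:
  assumes "length is = length (parts \<alpha>)"
  shows "vmonom is (parts \<alpha>) = 0 \<longleftrightarrow> parts \<alpha> = []"
proof
  assume "vmonom is (parts \<alpha>) = 0"
  hence "sum_list (parts \<alpha>) = 0"
    using mdegree_vmonom[OF assms] by simp
  thus "parts \<alpha> = []" using parts[of \<alpha>] by (cases "parts \<alpha>") auto
qed (simp add: vmonom_def)

lemma quasisymmetric_1: "quasisymmetric 1"
  by (rule quasisymmetricI[of _ 0]) (auto simp: one_pseries.rep_eq vmonom_eq_0_iff split: if_splits)

lemma quasisymmetric_add:
  assumes "quasisymmetric f" "quasisymmetric g"
  shows "quasisymmetric (f + g)"
proof -
  obtain d where d: "\<forall>m. coeff f m \<noteq> 0 \<longrightarrow> mdegree m \<le> d"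
    using quasisymmetric_bound[OF assms(1)] ..
  obtain e where e: "\<forall>m. coeff g m \<noteq> 0 \<longrightarrow> mdegree m \<le> e"
    using quasisymmetric_bound[OF assms(2)] ..
  show ?thesis
  proof (rule quasisymmetricI)
    show "mdegree m \<le> max d e" if "coeff (f + g) m \<noteq> 0" for m
      using that d[rule_format, of m] e[rule_format, of m] by (cases "coeff f m = 0") (auto simp: plus_pseries.rep_eq)
  next
    fix \<alpha> and "is" js :: "nat list"
    assume *: "length is = length (parts \<alpha>)" "sorted_wrt (<) is"
      "length js = length (parts \<alpha>)" "sorted_wrt (<) js"
    show "coeff (f + g) (vmonom is (parts \<alpha>)) = coeff (f + g) (vmonom js (parts \<alpha>))"
      using quasisymmetric_weak[OF assms(1) *] quasisymmetric_weak[OF assms(2) *]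
      by (simp add: plus_pseries.rep_eq)
  qed
qed

lift_definition pscale :: "rat \<Rightarrow> pseries \<Rightarrow> pseries" is "\<lambda>c f m. c * f m" .

lemma quasisymmetric_pscale:
  assumes "quasisymmetric f"
  shows "quasisymmetric (pscale c f)"
proof -
  obtain d where d: "\<forall>m. coeff f m \<noteq> 0 \<longrightarrow> mdegree m \<le> d"
    using quasisymmetric_bound[OF assms] ..
  show ?thesis
  proof (rule quasisymmetricI)
    show "mdegree m \<le> d" if "coeff (pscale c f) m \<noteq> 0" for m
      using that d[rule_format, of m] by (simp add: pscale.rep_eq)
  next
    fix \<alpha> and "is" js :: "nat list"
    assume *: "length is = length (parts \<alpha>)" "sorted_wrt (<) is"
      "length js = length (parts \<alpha>)" "sorted_wrt (<) js"
    show "coeff (pscale c f) (vmonom is (parts \<alpha>)) = coeff (pscale c f) (vmonom js (parts \<alpha>))"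
      using quasisymmetric_weak[OF assms *] by (simp add: pscale.rep_eq)
  qed
qed

lemma quasisymmetric_uminus: "quasisymmetric f \<Longrightarrow> quasisymmetric (- f)"
proof -
  have "- f = pscale (-1) f" by transfer auto
  thus "quasisymmetric f \<Longrightarrow> quasisymmetric (- f)" by (simp add: quasisymmetric_pscale)
qed

lemma quasisymmetric_diff: "quasisymmetric f \<Longrightarrow> quasisymmetric g \<Longrightarrow> quasisymmetric (f - g)"
  using quasisymmetric_add[OF _ quasisymmetric_uminus, of f g] by simp

typedef qsym = "{f. quasisymmetric f}"
  morphisms series_of QSym
  using quasisymmetric_0 by blast

setup_lifting type_definition_qsym

instantiation qsym :: comm_ring_1
begin

lift_definition zero_qsym :: qsym is 0 by (rule quasisymmetric_0)
lift_definition one_qsym :: qsym is 1 by (rule quasisymmetric_1)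
lift_definition plus_qsym :: "qsym \<Rightarrow> qsym \<Rightarrow> qsym" is "(+)" by (rule quasisymmetric_add)
lift_definition uminus_qsym :: "qsym \<Rightarrow> qsym" is uminus by (rule quasisymmetric_uminus)
lift_definition minus_qsym :: "qsym \<Rightarrow> qsym \<Rightarrow> qsym" is "(-)" by (rule quasisymmetric_diff)
lift_definition times_qsym :: "qsym \<Rightarrow> qsym \<Rightarrow> qsym" is "(*)" by (rule quasisymmetric_mult)

instance
  by standard (transfer; simp add: algebra_simps)+

end

lift_definition qscale :: "rat \<Rightarrow> qsym \<Rightarrow> qsym" is pscale by (rule quasisymmetric_pscale)

lemma pscale_laws:
  "pscale a (f + g) = pscale a f + pscale a g"
  "pscale (a + b) f = pscale a f + pscale b f"
  "pscale a (pscale b f) = pscale (a * b) f"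
  "pscale 1 f = f"
  by (transfer, simp add: algebra_simps)+

lemma qscale_laws:
  "qscale a (f + g) = qscale a f + qscale a g"
  "qscale (a + b) f = qscale a f + qscale b f"
  "qscale a (qscale b f) = qscale (a * b) f"
  "qscale 1 f = f"
  by (transfer, simp add: pscale_laws)+

global_interpretation qsym: vector_space qscale
  by (rule vector_space.intro) (simp_all add: qscale_laws)

lemma keys_vmonom:
  assumes len: "length is = length (parts \<alpha>)" and sorted: "sorted_wrt (<) is"
  shows "Poly_Mapping.keys (vmonom is (parts \<alpha>)) = set is"
proof
  show "Poly_Mapping.keys (vmonom is (parts \<alpha>)) \<subseteq> set is"
    by (metis in_keys_iff lookup_vmonom_notin subsetI)
  show "set is \<subseteq> Poly_Mapping.keys (vmonom is (parts \<alpha>))"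
  proof
    fix i assume "i \<in> set is"
    hence "Poly_Mapping.lookup (vmonom is (parts \<alpha>)) i \<in>
           set (map (Poly_Mapping.lookup (vmonom is (parts \<alpha>))) is)"
      by simp
    also have "\<dots> = set (parts \<alpha>)"
      using map_lookup_vmonom[OF len] sorted by (simp only: strict_sorted_iff)
    finally have "Poly_Mapping.lookup (vmonom is (parts \<alpha>)) i \<noteq> 0"
      using parts[of \<alpha>] by (auto intro: gr0I)
    thus "i \<in> Poly_Mapping.keys (vmonom is (parts \<alpha>))"
      by (simp add: in_keys_iff)
  qed
qed

lemma vmonom_inject:
  assumes "length is = length (parts \<alpha>)" "sorted_wrt (<) is"
    and "length js = length (parts \<beta>)" "sorted_wrt (<) js"
    and eq: "vmonom is (parts \<alpha>) = vmonom js (parts \<beta>)"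
  shows "is = js" "\<alpha> = \<beta>"
proof -
  have "set is = set js"
    using keys_vmonom[OF assms(1,2)] keys_vmonom[OF assms(3,4)] eq by simp
  thus ij: "is = js"
    using assms(2,4) by (intro strict_sorted_equal)
  have "distinct is"
    using assms(2) by (simp only: strict_sorted_iff)
  hence "map (Poly_Mapping.lookup (vmonom is (parts \<alpha>))) is = parts \<alpha>"
    "map (Poly_Mapping.lookup (vmonom js (parts \<beta>))) js = parts \<beta>"
    using map_lookup_vmonom assms(1,3) ij by blast+
  hence "parts \<alpha> = parts \<beta>"
    using eq ij by metis
  thus "\<alpha> = \<beta>"
    by (simp add: parts_inject)
qed

text \<open>Since all parts of \<open>\<alpha>\<close> are positive, the exponent vector \<open>vmonom is (parts \<alpha>)\<close> determines the
  increasing list \<open>is\<close>; so every monomial in the defining sum of \<open>M \<alpha>\<close> occurs exactly once.\<close>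

lift_definition M :: "composition \<Rightarrow> qsym" is
  "\<lambda>\<alpha>. PSeries (\<lambda>m. if \<exists>is. length is = length (parts \<alpha>) \<and> sorted_wrt (<) is \<and>
                             m = vmonom is (parts \<alpha>) then 1 else 0)"
proof -
  fix \<alpha> :: composition
  let ?P = "\<lambda>m. \<exists>is. length is = length (parts \<alpha>) \<and> sorted_wrt (<) is \<and> m = vmonom is (parts \<alpha>)"
  let ?f = "PSeries (\<lambda>m. if ?P m then 1 else 0)"
  have coeff: "coeff ?f m = (if ?P m then 1 else 0)" for m
    by (simp add: PSeries_inverse)
  have inv: "?P (vmonom is (parts \<beta>)) \<longleftrightarrow> \<beta> = \<alpha>"
    if "length is = length (parts \<beta>)" "sorted_wrt (<) is" for \<beta> "is"
    using that vmonom_inject(2) by blast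
  show "quasisymmetric ?f"
  proof (rule quasisymmetricI)
    fix m assume "coeff ?f m \<noteq> 0"
    hence "?P m" using coeff[of m] by presburger
    thus "mdegree m \<le> csize \<alpha>"
      by (auto simp: csize.rep_eq mdegree_vmonom)
  next
    fix \<beta> and "is" js :: "nat list"
    assume "length is = length (parts \<beta>)" "sorted_wrt (<) is"
       "length js = length (parts \<beta>)" "sorted_wrt (<) js"
    thus "coeff ?f (vmonom is (parts \<beta>)) = coeff ?f (vmonom js (parts \<beta>))"
      by (simp only: coeff inv)
  qed
qed

definition F :: "composition \<Rightarrow> qsym" where
  "F \<alpha> = (\<Sum>\<beta> | refines \<beta> \<alpha>. M \<beta>)"

definition QSym_deg :: "nat \<Rightarrow> qsym set" where
  "QSym_deg n = qsym.span {M \<alpha> | \<alpha>. csize \<alpha> = n}"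

abbreviation qlinear :: "(qsym \<Rightarrow> qsym) \<Rightarrow> bool" where
  "qlinear \<equiv> Vector_Spaces.linear qscale qscale"

definition algebra_automorphism :: "(qsym \<Rightarrow> qsym) \<Rightarrow> bool" where
  "algebra_automorphism \<phi> \<longleftrightarrow>
     qlinear \<phi> \<and> \<phi> 1 = 1 \<and> (\<forall>f g. \<phi> (f * g) = \<phi> f * \<phi> g) \<and> bij \<phi>"

definition graded :: "(qsym \<Rightarrow> qsym) \<Rightarrow> bool" where
  "graded \<phi> \<longleftrightarrow> (\<forall>n. \<phi> ` QSym_deg n \<subseteq> QSym_deg n)"

definition nontrivial_monomial_automorphism :: "(qsym \<Rightarrow> qsym) \<Rightarrow> bool" where
  "nontrivial_monomial_automorphism \<phi> \<longleftrightarrow>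
     algebra_automorphism \<phi> \<and> graded \<phi> \<and> \<phi> \<noteq> id \<and> \<phi> ` range M = range M"

end

theory Submission
  imports Defs "HOL-Library.Multiset"
begin

text \<open>
  Reversal commutes with refinement, so \<open>\<rho>\<close> must send \<open>M \<alpha>\<close> to \<open>M (crev \<alpha>)\<close>; on coefficients this
  means reading every exponent list backwards. A coefficient of \<open>f * g\<close> is a sum over the ways to
  split an exponent list entrywise into two, and splitting commutes with reading backwards. Hence
  \<open>\<rho>\<close> is multiplicative (lemma \<open>reversal_mult\<close>), and the remaining properties of \<open>\<rho>\<close> are immediate.

  For uniqueness, let \<open>\<phi>\<close> be a graded automorphism permuting the \<open>M \<alpha>\<close>, say
  \<open>\<phi> (M \<alpha>) = M (\<sigma> \<alpha>)\<close>. There is only one composition of size 1, so \<open>\<phi>\<close> fixes \<open>M C1\<close>, where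
  \<open>C1 = (1)\<close>. The coefficient of \<open>M \<alpha>\<close> in \<open>M C1 * M \<gamma>\<close> is the number of parts of \<open>\<alpha>\<close> that yield \<open>\<gamma>\<close>
  when lowered by one, a part that becomes 0 being dropped (lemma \<open>qcoeff_M1_mult\<close>). Call the
  multiset of all these results the deck of \<open>\<alpha>\<close>. If \<open>\<sigma>\<close> fixes all compositions smaller than \<open>\<alpha>\<close>,
  then \<open>\<alpha>\<close> and \<open>\<sigma> \<alpha>\<close> have the same deck.

  A composition is determined by its size and its deck, with the one exception that \<open>(1,2)\<close> and
  \<open>(2,1)\<close> share a deck (lemma \<open>eq_if_same_deck\<close>). By induction on the size, \<open>\<sigma>\<close> is the identity as
  soon as it fixes \<open>(1,2)\<close>. Otherwise \<open>\<sigma>\<close> swaps \<open>(1,2)\<close> and \<open>(2,1)\<close>, so \<open>\<rho> \<circ> \<phi>\<close> fixes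
  \<open>M C12\<close> for \<open>C12 = (1,2)\<close> and is the identity; as \<open>\<rho>\<close> is an involution, \<open>\<phi> = \<rho>\<close>.
\<close>

section \<open>Quasisymmetric functions by their coefficients\<close>

text \<open>Quasisymmetry lets the variables be chosen freely, so a coefficient is addressed by its
  exponent list alone. Zero exponents are admitted because they arise in the factors when a
  monomial is split in two.\<close>

definition qcoeff :: "qsym \<Rightarrow> nat list \<Rightarrow> rat" where
  "qcoeff f as = coeff (series_of f) (vmonom [0..<length as] as)"

definition strip :: "nat list \<Rightarrow> nat list" where
  "strip as = filter (\<lambda>a. a \<noteq> 0) as"

lemma zero_notin_strip [simp]: "0 \<notin> set (strip as)"
  by (simp add: strip_def)

lemma zero_notin_parts [simp]: "0 \<notin> set (parts \<alpha>)"
  using parts[of \<alpha>] by simp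

lemma parts_Composition [simp]: "0 \<notin> set as \<Longrightarrow> parts (Composition as) = as"
  by (simp add: Composition_inverse)

lemma strip_ident: "0 \<notin> set as \<Longrightarrow> strip as = as"
  by (auto simp: strip_def filter_id_conv intro: gr0I)

lemma strip_parts [simp]: "strip (parts \<alpha>) = parts \<alpha>"
  by (simp add: strip_ident)

lemma coeff_eq_qcoeff:
  assumes "length is = length as" "sorted_wrt (<) is"
  shows "coeff (series_of f) (vmonom is as) = qcoeff f as"
  unfolding qcoeff_def
  by (rule quasisymmetric_weak) (use assms series_of[of f] in auto)

lemma qcoeff_strip: "qcoeff f (strip as) = qcoeff f as"
proof -
  let ?P = "\<lambda>p. snd p \<noteq> (0::nat)"
  let ?is = "[0..<length as]"
  have snd: "map snd (filter ?P (zip ?is as)) = strip as"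
    using filter_zip_snd[of ?is as] by (simp add: strip_def)
  have "qcoeff f as = coeff (series_of f) (vmonom (map fst (filter ?P (zip ?is as))) (strip as))"
    unfolding qcoeff_def using vmonom_filter[of ?is as] snd by simp
  also have "\<dots> = qcoeff f (strip as)"
  proof (rule coeff_eq_qcoeff)
    show "length (map fst (filter ?P (zip ?is as))) = length (strip as)"
      using arg_cong[OF snd, of length] by simp
    show "sorted_wrt (<) (map fst (filter ?P (zip ?is as)))"
      by (rule filter_zip_sorted) auto
  qed
  finally show ?thesis by simp
qed

lemma qcoeff_eqI:
  assumes "\<And>\<alpha>. qcoeff f (parts \<alpha>) = qcoeff g (parts \<alpha>)"
  shows "f = g"
proof -
  have "coeff (series_of f) m = coeff (series_of g) m" for m
  proof -
    define "is" where "is = sorted_list_of_set (Poly_Mapping.keys m)"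
    define as where "as = map (Poly_Mapping.lookup m) is"
    have "distinct is" "Poly_Mapping.keys m = set is" "sorted_wrt (<) is"
      by (auto simp: is_def)
    hence m: "m = vmonom is as"
      unfolding as_def by (subst vmonom_map_lookup) auto
    have as: "0 \<notin> set as"
    proof
      assume "0 \<in> set as"
      then obtain i where "i \<in> set is" "Poly_Mapping.lookup m i = 0" by (auto simp: as_def)
      thus False using in_keys_iff[of i m] \<open>Poly_Mapping.keys m = set is\<close> by simp
    qed
    have "length is = length as" by (simp add: as_def)
    hence "coeff (series_of h) m = qcoeff h (parts (Composition as))" for h
      unfolding m using as \<open>sorted_wrt (<) is\<close> by (simp add: coeff_eq_qcoeff)
    thus ?thesis using assms by simp
  qed
  hence "series_of f = series_of g" by (rule pseries_eqI)
  thus ?thesis by (simp add: series_of_inject)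
qed

lemma qcoeff_0 [simp]: "qcoeff 0 as = 0"
  by (simp add: qcoeff_def zero_qsym.rep_eq zero_pseries.rep_eq)

lemma qcoeff_add [simp]: "qcoeff (f + g) as = qcoeff f as + qcoeff g as"
  by (simp add: qcoeff_def plus_qsym.rep_eq plus_pseries.rep_eq)

lemma qcoeff_scale [simp]: "qcoeff (qscale c f) as = c * qcoeff f as"
  by (simp add: qcoeff_def qscale.rep_eq pscale.rep_eq)

lemma qcoeff_sum: "qcoeff (\<Sum>x\<in>A. f x) as = (\<Sum>x\<in>A. qcoeff (f x) as)"
  by (induction A rule: infinite_finite_induct) auto

lemma qcoeff_M: "qcoeff (M \<beta>) as = (if strip as = parts \<beta> then 1 else 0)"
proof -
  define \<alpha> where "\<alpha> = Composition (strip as)"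
  have \<alpha>: "parts \<alpha> = strip as" by (simp add: \<alpha>_def)
  have "(\<exists>is. length is = length (parts \<beta>) \<and> sorted_wrt (<) is \<and>
           vmonom [0..<length (parts \<alpha>)] (parts \<alpha>) = vmonom is (parts \<beta>)) \<longleftrightarrow> \<alpha> = \<beta>"
  proof
    assume "\<alpha> = \<beta>"
    thus "\<exists>is. length is = length (parts \<beta>) \<and> sorted_wrt (<) is \<and>
           vmonom [0..<length (parts \<alpha>)] (parts \<alpha>) = vmonom is (parts \<beta>)"
      by (intro exI[of _ "[0..<length (parts \<beta>)]"]) auto
  qed (use vmonom_inject(2)[of "[0..<length (parts \<alpha>)]" \<alpha> _ \<beta>] in auto)
  hence "qcoeff (M \<beta>) (parts \<alpha>) = (if \<alpha> = \<beta> then 1 else 0)"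
    by (simp add: qcoeff_def M.rep_eq PSeries_inverse)
  thus ?thesis using qcoeff_strip[of "M \<beta>" as] by (simp add: \<alpha>[symmetric] parts_inject)
qed

lemma qcoeff_M_parts: "qcoeff (M \<beta>) (parts \<alpha>) = (if \<alpha> = \<beta> then 1 else 0)"
  by (simp add: qcoeff_M parts_inject)

lemma M_inject [simp]: "M \<alpha> = M \<beta> \<longleftrightarrow> \<alpha> = \<beta>"
  using qcoeff_M_parts[of \<alpha> \<alpha>] qcoeff_M_parts[of \<beta> \<alpha>] by (metis zero_neq_one)

lemma finite_support: "finite {\<alpha>. qcoeff f (parts \<alpha>) \<noteq> 0}"
proof -
  obtain d where d: "\<And>m. coeff (series_of f) m \<noteq> 0 \<Longrightarrow> mdegree m \<le> d"
    using quasisymmetric_bound[of "series_of f"] series_of[of f] by auto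
  have "csize \<alpha> \<le> d" if "qcoeff f (parts \<alpha>) \<noteq> 0" for \<alpha>
    using d[of "vmonom [0..<length (parts \<alpha>)] (parts \<alpha>)"] that
    by (simp add: qcoeff_def mdegree_vmonom csize.rep_eq)
  hence "{\<alpha>. qcoeff f (parts \<alpha>) \<noteq> 0} \<subseteq> (\<Union>n\<in>{..d}. {\<alpha>. csize \<alpha> = n})" by auto
  thus ?thesis by (rule finite_subset) (auto simp: finite_csize)
qed

lemma M_expansion:
  "f = (\<Sum>\<alpha> | qcoeff f (parts \<alpha>) \<noteq> 0. qscale (qcoeff f (parts \<alpha>)) (M \<alpha>))"
proof (rule qcoeff_eqI)
  fix \<beta>
  show "qcoeff f (parts \<beta>) =
    qcoeff (\<Sum>\<alpha> | qcoeff f (parts \<alpha>) \<noteq> 0. qscale (qcoeff f (parts \<alpha>)) (M \<alpha>)) (parts \<beta>)"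
    using finite_support[of f] by (simp add: qcoeff_sum qcoeff_M_parts if_distrib cong: if_cong)
qed

lemma qcoeff_mult:
  "qcoeff (f * g) as =
     (\<Sum>cs | length cs = length as \<and> list_all2 (\<le>) cs as. qcoeff f cs * qcoeff g (map2 (-) as cs))"
  by (subst (1) qcoeff_def) (auto simp: times_qsym.rep_eq coeff_mult_vmonom coeff_eq_qcoeff
      intro!: sum.cong)

lemma qlinear_eq_if_eq_on_M:
  assumes "qlinear \<phi>" "qlinear \<psi>" "\<And>\<alpha>. \<phi> (M \<alpha>) = \<psi> (M \<alpha>)"
  shows "\<phi> = \<psi>"
proof
  interpret \<phi>: Vector_Spaces.linear qscale qscale \<phi> by fact
  interpret \<psi>: Vector_Spaces.linear qscale qscale \<psi> by fact
  fix f
  show "\<phi> f = \<psi> f"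
    by (subst (1 2) M_expansion[of f]) (simp add: \<phi>.sum \<psi>.sum \<phi>.scale \<psi>.scale assms(3))
qed

text \<open>Membership in a graded piece becomes a condition on coefficients, which reversal visibly
  preserves and which recovers the size of \<open>\<alpha>\<close> from \<open>M \<alpha>\<close>.\<close>

lemma mem_QSym_deg_iff: "f \<in> QSym_deg n \<longleftrightarrow> (\<forall>\<alpha>. qcoeff f (parts \<alpha>) \<noteq> 0 \<longrightarrow> csize \<alpha> = n)"
proof
  assume "f \<in> QSym_deg n"
  thus "\<forall>\<alpha>. qcoeff f (parts \<alpha>) \<noteq> 0 \<longrightarrow> csize \<alpha> = n"
    unfolding QSym_deg_def
  proof (induction rule: qsym.span_induct_alt)
    case (step c x y)
    then obtain \<beta> where "x = M \<beta>" "csize \<beta> = n" by auto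
    thus ?case using step.IH by (auto simp: qcoeff_M_parts)
  qed simp
next
  assume "\<forall>\<alpha>. qcoeff f (parts \<alpha>) \<noteq> 0 \<longrightarrow> csize \<alpha> = n"
  hence "(\<Sum>\<alpha> | qcoeff f (parts \<alpha>) \<noteq> 0. qscale (qcoeff f (parts \<alpha>)) (M \<alpha>)) \<in> QSym_deg n"
    unfolding QSym_deg_def by (intro qsym.span_sum qsym.span_scale qsym.span_base) blast
  thus "f \<in> QSym_deg n"
    using M_expansion[of f] by simp
qed

section \<open>The reversal automorphism\<close>

lemma crev_crev [simp]: "crev (crev \<alpha>) = \<alpha>"
  by transfer simp

lemma csize_crev [simp]: "csize (crev \<alpha>) = csize \<alpha>"
  by transfer simp

lemma strip_rev: "strip (rev as) = rev (strip as)"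
  by (simp add: strip_def rev_filter)

lemma refines_crev_if: "refines \<beta> \<alpha> \<Longrightarrow> refines (crev \<beta>) (crev \<alpha>)"
proof -
  assume "refines \<beta> \<alpha>"
  then obtain bs where bs: "[] \<notin> set bs" "concat bs = parts \<beta>" "map sum_list bs = parts \<alpha>"
    by (auto simp: refines_def)
  have "map sum_list (rev (map rev bs)) = rev (map sum_list bs)"
    by (simp add: rev_map o_def)
  moreover have "concat (rev (map rev bs)) = rev (concat bs)"
    by (simp add: rev_concat rev_map)
  ultimately show ?thesis
    unfolding refines_def crev.rep_eq using bs
    by (intro exI[of _ "rev (map rev bs)"]) auto
qed

lemma refines_crev: "refines (crev \<beta>) \<alpha> \<longleftrightarrow> refines \<beta> (crev \<alpha>)"
  using refines_crev_if[of "crev \<beta>" \<alpha>] refines_crev_if[of \<beta> "crev \<alpha>"] by auto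

definition reversal :: "qsym \<Rightarrow> qsym" where
  "reversal f = (\<Sum>\<alpha> | qcoeff f (parts \<alpha>) \<noteq> 0. qscale (qcoeff f (parts \<alpha>)) (M (crev \<alpha>)))"

lemma qcoeff_reversal: "qcoeff (reversal f) as = qcoeff f (rev as)"
proof -
  have parts: "qcoeff (reversal f) (parts \<beta>) = qcoeff f (parts (crev \<beta>))" for \<beta>
  proof -
    have eq: "\<beta> = crev \<alpha> \<longleftrightarrow> crev \<beta> = \<alpha>" for \<alpha> by auto
    show ?thesis
      using finite_support[of f]
      by (simp add: reversal_def qcoeff_sum qcoeff_M_parts if_distrib eq cong: if_cong)
  qed
  have "qcoeff (reversal f) (strip as) = qcoeff f (strip (rev as))"
    using parts[of "Composition (strip as)"] by (simp add: crev.rep_eq strip_rev)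
  thus ?thesis by (simp add: qcoeff_strip)
qed

lemma qlinear_reversal: "qlinear reversal"
proof -
  have "reversal (f + g) = reversal f + reversal g" "reversal (qscale c f) = qscale c (reversal f)" for c f g
    by (rule qcoeff_eqI, simp add: qcoeff_reversal)+
  thus ?thesis
    by (simp add: Vector_Spaces.linear_iff qsym.vector_space_axioms)
qed

lemma reversal_M: "reversal (M \<alpha>) = M (crev \<alpha>)"
  by (rule qcoeff_eqI) (simp add: qcoeff_reversal qcoeff_M strip_rev crev.rep_eq rev_swap)

lemma reversal_reversal [simp]: "reversal (reversal f) = f"
  by (rule qcoeff_eqI) (simp add: qcoeff_reversal)

lemma reversal_F: "reversal (F \<alpha>) = F (crev \<alpha>)"
proof -
  interpret Vector_Spaces.linear qscale qscale reversal by (rule qlinear_reversal)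
  have "reversal (F \<alpha>) = (\<Sum>\<beta> | refines \<beta> \<alpha>. M (crev \<beta>))"
    by (simp add: F_def sum reversal_M)
  also have "\<dots> = F (crev \<alpha>)"
    unfolding F_def
    by (rule sum.reindex_bij_witness[of _ crev crev]) (auto simp: refines_crev)
  finally show ?thesis .
qed

text \<open>Reading all exponent lists backwards is a bijection between the splittings of a list and those
  of its reversal.\<close>

lemma reversal_mult: "reversal (f * g) = reversal f * reversal g"
proof (rule qcoeff_eqI)
  fix \<alpha>
  let ?as = "parts \<alpha>"
  show "qcoeff (reversal (f * g)) ?as = qcoeff (reversal f * reversal g) ?as"
    unfolding qcoeff_reversal qcoeff_mult
  proof (rule sum.reindex_bij_witness[of _ rev rev], goal_cases)
    case (5 cs)
    hence "map2 (-) ?as (rev cs) = rev (map2 (-) (rev ?as) cs)"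
      by (simp add: zip_rev[of "rev ?as" cs, symmetric] rev_map)
    thus ?case by (simp add: qcoeff_reversal)
  next
    case (2 cs)
    thus ?case by (simp add: list_all2_rev[of _ cs "rev ?as", symmetric, unfolded rev_rev_ident])
  qed auto
qed

section \<open>Triangularity of the fundamental basis\<close>

lemma length_parts_le: "length (parts \<alpha>) \<le> csize \<alpha>"
proof -
  have "0 \<notin> set as \<Longrightarrow> length as \<le> sum_list as" for as :: "nat list"
    by (induction as) auto
  thus ?thesis by (simp add: csize.rep_eq)
qed

lemma refines_refl: "refines \<alpha> \<alpha>"
  unfolding refines_def by (rule exI[of _ "map (\<lambda>a. [a]) (parts \<alpha>)"]) (auto simp: o_def)

lemma length_less_if_refines:
  assumes "refines \<beta> \<alpha>" "\<beta> \<noteq> \<alpha>"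
  shows "length (parts \<alpha>) < length (parts \<beta>)"
proof -
  have gen: "[] \<notin> set bs \<Longrightarrow> length bs \<le> length (concat bs) \<and>
      (length bs = length (concat bs) \<longrightarrow> map sum_list bs = concat bs)" for bs :: "nat list list"
  proof (induction bs)
    case (Cons b bs)
    then obtain x xs where "b = x # xs" by (cases b) auto
    thus ?case using Cons by auto
  qed simp
  obtain bs where "[] \<notin> set bs" "concat bs = parts \<beta>" "map sum_list bs = parts \<alpha>"
    using assms(1) by (auto simp: refines_def)
  moreover from this have "length (parts \<alpha>) = length bs" by (metis length_map)
  ultimately show ?thesis
    using gen[of bs] assms(2) by (metis le_neq_implies_less parts_inject)
qed

text \<open>\<open>F \<alpha>\<close> is \<open>M \<alpha>\<close> plus terms \<open>M \<beta>\<close> of the same size with more parts. The number of parts is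
  at most the size, so each \<open>M \<alpha>\<close> can be solved for by recursion on the difference of the two.\<close>

lemma qlinear_eq_if_eq_on_F:
  assumes \<phi>: "qlinear \<phi>" and \<psi>: "qlinear \<psi>" and eq: "\<And>\<alpha>. \<phi> (F \<alpha>) = \<psi> (F \<alpha>)"
  shows "\<phi> = \<psi>"
proof (rule qlinear_eq_if_eq_on_M[OF \<phi> \<psi>])
  interpret \<phi>: Vector_Spaces.linear qscale qscale \<phi> by fact
  interpret \<psi>: Vector_Spaces.linear qscale qscale \<psi> by fact
  fix \<alpha>
  show "\<phi> (M \<alpha>) = \<psi> (M \<alpha>)"
  proof (induction \<alpha> rule: measure_induct_rule[of "\<lambda>\<alpha>. csize \<alpha> - length (parts \<alpha>)"])
    case (less \<alpha>)
    let ?R = "{\<beta>. refines \<beta> \<alpha>} - {\<alpha>}"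
    have "\<phi> (M \<beta>) = \<psi> (M \<beta>)" if "\<beta> \<in> ?R" for \<beta>
      using that length_less_if_refines[of \<beta> \<alpha>] csize_eq_if_refines[of \<beta> \<alpha>] length_parts_le[of \<beta>]
      by (intro less) auto
    moreover have "F \<alpha> = M \<alpha> + (\<Sum>\<beta>\<in>?R. M \<beta>)"
      unfolding F_def by (rule sum.remove) (auto simp: finite_refines refines_refl)
    ultimately show ?case
      using eq[of \<alpha>] by (simp add: \<phi>.add \<psi>.add \<phi>.sum \<psi>.sum)
  qed
qed

section \<open>Compositions from their decks\<close>

text \<open>The multiset of all \<open>lowered as i\<close> is the deck of \<open>as\<close>. Stripping zeros drops a part that was 1,
  so an entry of the deck has as many parts as \<open>as\<close> or one fewer.\<close>

definition lowered :: "nat list \<Rightarrow> nat \<Rightarrow> nat list" where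
  "lowered as i = strip (as[i := as ! i - 1])"

lemma lowered_eq:
  assumes "0 \<notin> set as" "i < length as"
  shows "lowered as i = (if as ! i = 1 then take i as @ drop (Suc i) as else as[i := as ! i - 1])"
proof -
  have "0 \<notin> set (take i as)" "0 \<notin> set (drop (Suc i) as)"
    using assms(1) by (auto dest: in_set_takeD in_set_dropD)
  moreover have "as ! i \<noteq> 0" using assms by (metis nth_mem)
  ultimately have *: "strip (take i as) = take i as" "strip (drop (Suc i) as) = drop (Suc i) as"
    "as ! i \<noteq> 0" by (simp_all add: strip_ident)
  have "strip (as[i := a]) = take i as @ strip [a] @ drop (Suc i) as" for a
    using assms(2) *(1,2) by (simp add: upd_conv_take_nth_drop strip_def)
  moreover have "strip [a] = (if a = 0 then [] else [a])" for a
    by (simp add: strip_def)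
  ultimately show ?thesis
    unfolding lowered_def using assms(2) *(3) by (simp add: upd_conv_take_nth_drop)
qed

lemma length_lowered:
  assumes "0 \<notin> set as" "i < length as"
  shows "length (lowered as i) = (if as ! i = 1 then length as - 1 else length as)"
  using assms by (simp add: lowered_eq)

lemma sum_list_strip: "sum_list (strip as) = sum_list as"
  unfolding strip_def by (induction as) auto

lemma sum_lowered:
  assumes "0 \<notin> set as" "i < length as"
  shows "sum_list (lowered as i) < sum_list as"
proof -
  have "as ! i \<noteq> 0" using assms by (metis nth_mem)
  moreover have "as ! i \<le> sum_list as" using assms by (simp add: member_le_sum_list)
  ultimately show ?thesis
    using assms(2) by (simp add: lowered_def sum_list_strip sum_list_update)
qed

lemma strip_eq_single:
  "strip cs = [1] \<longleftrightarrow> (\<exists>i<length cs. cs = (replicate (length cs) 0)[i := 1])"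
proof
  assume "strip cs = [1]"
  then obtain us vs where cs: "cs = us @ 1 # vs" "\<forall>a\<in>set us. a = 0" "[] = filter (\<lambda>a. a \<noteq> 0) vs"
    unfolding strip_def filter_eq_Cons_iff by blast
  from cs(3) have "\<forall>a\<in>set vs. a = 0" by (metis (mono_tags, lifting) filter_empty_conv)
  with cs(2) have "us = replicate (length us) 0" "vs = replicate (length vs) 0"
    by (auto intro!: replicate_eqI)
  hence "cs = replicate (length us) 0 @ 1 # replicate (length vs) 0"
    using cs(1) by simp
  also have "\<dots> = (replicate (length us + Suc (length vs)) 0)[length us := 1]"
    by (simp only: replicate_add list_update_append length_replicate) simp
  finally have eq: "cs = (replicate (length us + Suc (length vs)) 0)[length us := 1]" .
  have "length us + Suc (length vs) = length cs" using cs(1) by simp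
  moreover from this have "length us < length cs" by simp
  moreover have "cs = (replicate (length cs) 0)[length us := 1]" using eq calculation(1) by argo
  ultimately show "\<exists>i<length cs. cs = (replicate (length cs) 0)[i := 1]" by blast
next
  assume "\<exists>i<length cs. cs = (replicate (length cs) 0)[i := 1]"
  then obtain i where "i < length cs" and cs: "cs = (replicate (length cs) 0)[i := 1]" by blast
  moreover have "strip ((replicate n 0)[i := 1]) = [1]" if "i < n" for n
    using that by (simp add: upd_conv_take_nth_drop strip_def)
  ultimately show "strip cs = [1]" by metis
qed

text \<open>In a splitting of \<open>parts \<alpha>\<close> that contributes, the exponent list of the factor \<open>M C1\<close> is a unit
  vector \<open>u i\<close>, which leaves \<open>parts \<alpha>\<close> lowered at \<open>i\<close> for the factor \<open>M \<gamma>\<close>.\<close>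

lemma qcoeff_M1_mult:
  "qcoeff (M (Composition [1]) * M \<gamma>) (parts \<alpha>) =
     of_nat (card {i. i < length (parts \<alpha>) \<and> lowered (parts \<alpha>) i = parts \<gamma>})"
proof -
  let ?as = "parts \<alpha>"
  let ?n = "length ?as"
  let ?S = "{cs. length cs = ?n \<and> list_all2 (\<le>) cs ?as}"
  define u where "u i = (replicate ?n 0)[i := Suc 0]" for i
  have pos: "?as ! i \<noteq> 0" if "i < ?n" for i
    using that zero_notin_parts[of \<alpha>] by (metis nth_mem)
  have "finite ?S"
  proof (rule finite_subset[OF _ finite_lists_length_eq[of "{..sum_list ?as}" ?n]])
    have "cs ! i \<le> sum_list ?as" if "i < ?n" "list_all2 (\<le>) cs ?as" for cs i
      using list_all2_nthD2[OF that(2,1)] elem_le_sum_list[OF that(1)] by simp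
    thus "?S \<subseteq> {cs. set cs \<subseteq> {..sum_list ?as} \<and> length cs = ?n}"
      by (auto simp: in_set_conv_nth)
  qed simp
  have u_S: "u i \<in> ?S" if "i < ?n" for i
    using pos[OF that] that by (auto simp: u_def list_all2_conv_all_nth nth_list_update Suc_le_eq)
  have inj: "inj_on u {..<?n}"
  proof (rule inj_onI)
    fix i k assume "i \<in> {..<?n}" "k \<in> {..<?n}" "u i = u k"
    moreover have "u i ! i = Suc 0" using \<open>i \<in> {..<?n}\<close> by (simp add: u_def)
    ultimately have "u k ! i = Suc 0" by metis
    thus "i = k"
      using \<open>i \<in> {..<?n}\<close> by (cases "i = k") (simp_all add: u_def)
  qed
  have sub: "map2 (-) ?as (u i) = ?as[i := ?as ! i - 1]" if "i < ?n" for i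
    using that by (intro nth_equalityI) (auto simp: u_def nth_list_update)
  have "qcoeff (M (Composition [1]) * M \<gamma>) ?as =
        (\<Sum>cs\<in>?S. if strip cs = [1] \<and> strip (map2 (-) ?as cs) = parts \<gamma> then 1 else 0)"
    unfolding qcoeff_mult by (rule sum.cong) (auto simp: qcoeff_M)
  also have "\<dots> = (\<Sum>cs\<in>u ` {..<?n}. if strip (map2 (-) ?as cs) = parts \<gamma> then 1 else 0)"
  proof (rule sum.mono_neutral_cong_right)
    have "strip (u i) = [1]" if "i < ?n" for i
      using that strip_eq_single[of "u i"] by (auto simp: u_def)
    thus "(if strip cs = [1] \<and> strip (map2 (-) ?as cs) = parts \<gamma> then 1 else 0) =
          (if strip (map2 (-) ?as cs) = parts \<gamma> then 1 else (0::rat))" if "cs \<in> u ` {..<?n}" for cs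
      using that by auto
    show "\<forall>cs\<in>?S - u ` {..<?n}.
        (if strip cs = [1] \<and> strip (map2 (-) ?as cs) = parts \<gamma> then 1 else 0) = (0::rat)"
      by (auto simp: strip_eq_single[unfolded One_nat_def] u_def)
  qed (use u_S \<open>finite ?S\<close> in auto)
  also have "\<dots> = (\<Sum>i<?n. if lowered ?as i = parts \<gamma> then 1 else 0)"
    by (subst sum.reindex[OF inj]) (auto simp: sub lowered_def intro!: sum.cong)
  also have "\<dots> = of_nat (card ({..<?n} \<inter> {i. lowered ?as i = parts \<gamma>}))"
    by (simp add: sum.If_cases)
  also have "{..<?n} \<inter> {i. lowered ?as i = parts \<gamma>} =
             {i. i < ?n \<and> lowered ?as i = parts \<gamma>}" by auto
  finally show ?thesis .
qed

text \<open>If some \<open>as ! i \<ge> 2\<close> with \<open>i \<noteq> j\<close>, then lowering \<open>as\<close> at \<open>i\<close> keeps both the length and the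
  large entry at \<open>j\<close>. But an entry of the deck of \<open>bs\<close> that has full length is bounded by \<open>bs\<close>
  entrywise.\<close>

lemma others_eq_1_if_greater:
  assumes pos: "0 \<notin> set as" "0 \<notin> set bs" and len: "length as = length bs"
    and deck: "lowered as ` {..<length as} \<subseteq> lowered bs ` {..<length bs}"
    and j: "j < length as" "as ! j > bs ! j" and i: "i < length as" "i \<noteq> j"
  shows "as ! i = 1"
proof (rule ccontr)
  assume "as ! i \<noteq> 1"
  hence l: "lowered as i = as[i := as ! i - 1]" using lowered_eq[OF pos(1) i(1)] by simp
  obtain i' where i': "i' < length bs" "lowered as i = lowered bs i'"
    using deck i(1) by blast
  have "bs ! i' \<noteq> 1"
    using arg_cong[OF i'(2), of length] length_lowered[OF pos(2) i'(1)] i'(1) len l by auto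
  hence "as[i := as ! i - 1] = bs[i' := bs ! i' - 1]"
    using l i' lowered_eq[OF pos(2) i'(1)] by simp
  hence "as ! j = bs[i' := bs ! i' - 1] ! j" using i(2) by (metis nth_list_update_neq)
  also have "\<dots> \<le> bs ! j" using j(1) len by (cases "i' = j") simp_all
  finally show False using j(2) by simp
qed

lemma lowered_single_2:
  fixes l j i :: nat
  defines "as \<equiv> (replicate l (1::nat))[j := 2]"
  assumes "j < l" "i < l" "i \<noteq> j"
  shows "lowered as i = (replicate (l - 1) 1)[(if i < j then j - 1 else j) := 2]"
proof -
  have pos: "0 \<notin> set as"
    using set_update_subset_insert[of "replicate l (1::nat)" j 2] by (auto simp: as_def)
  have l: "lowered as i = take i as @ drop (Suc i) as"
    using assms lowered_eq[OF pos, of i] by (simp add: as_def)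
  show ?thesis
    unfolding l using assms(2-)
    by (intro nth_equalityI) (auto simp: as_def nth_append nth_list_update min_def)
qed

text \<open>Only the entries of the deck that come from removing a 1 matter; each is recorded by the
  position of its 2. If \<open>bs\<close> did not end with its 2, removing its last 1 would give a position too
  high for the deck of \<open>as\<close>; if \<open>as\<close> did not start with its 2, removing its first 1 would give one
  too low for the deck of \<open>bs\<close>. If then \<open>l \<ge> 3\<close>, the 2 of \<open>as\<close> can stay at position 0, which that of
  \<open>bs\<close> cannot reach.\<close>

lemma single_2_same_deck:
  fixes l j k :: nat
  defines "as \<equiv> (replicate l (1::nat))[j := 2]" and "bs \<equiv> (replicate l (1::nat))[k := 2]"
  assumes jk: "j < k" "k < l" and deck: "lowered as ` {..<l} = lowered bs ` {..<l}"
  shows "as = [2, 1] \<and> bs = [1, 2]"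
proof -
  let ?e = "\<lambda>n p. (replicate n (1::nat))[p := 2]"
  have e_inj: "p = q" if "?e n p = ?e n q" "p < n" for n p q
    using arg_cong[OF that(1), of "\<lambda>xs. xs ! p"] that(2) by (cases "p = q") simp_all
  have pos: "0 \<notin> set (?e l p)" for p
    using set_update_subset_insert[of "replicate l (1::nat)" p 2] by auto
  \<comment> \<open>Removing an entry 1 leaves the 2 in place or moves it down by one.\<close>
  have pos_2: "\<exists>i'<l. i' \<noteq> q \<and> (if i < p then p - 1 else p) = (if i' < q then q - 1 else q)"
    if deck: "lowered (?e l p) ` {..<l} \<subseteq> lowered (?e l q) ` {..<l}"
      and p: "p < l" and q: "q < l" and i: "i < l" "i \<noteq> p" for p q i
  proof -
    obtain i' where i': "i' < l" "lowered (?e l p) i = lowered (?e l q) i'"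
      using deck i(1) by blast
    have "i' \<noteq> q"
      using arg_cong[OF i'(2), of length] lowered_single_2[OF p i] i'(1) i(1)
        length_lowered[OF pos, of q q] by auto
    hence "?e (l - 1) (if i < p then p - 1 else p) = ?e (l - 1) (if i' < q then q - 1 else q)"
      using i'(2) lowered_single_2[OF p i] lowered_single_2[OF q i'(1)] by simp
    hence "(if i < p then p - 1 else p) = (if i' < q then q - 1 else q)"
      by (rule e_inj) (use p i in auto)
    thus ?thesis using i'(1) \<open>i' \<noteq> q\<close> by blast
  qed
  have l: "j < l" "k < l" using jk by auto
  note jk_pos = pos_2[OF _ l(1,2)] and kj_pos = pos_2[OF _ l(2,1)]
  have deck': "lowered (?e l j) ` {..<l} \<subseteq> lowered (?e l k) ` {..<l}"
    "lowered (?e l k) ` {..<l} \<subseteq> lowered (?e l j) ` {..<l}"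
    using deck by (simp_all add: as_def bs_def)
  have "k = l - 1"
  proof (rule ccontr)
    assume "k \<noteq> l - 1"
    thus False using kj_pos[OF deck'(2), of "l - 1"] jk by (auto split: if_splits)
  qed
  moreover have "j = 0"
  proof (rule ccontr)
    assume "j \<noteq> 0"
    thus False using jk_pos[OF deck'(1), of 0] jk by (auto split: if_splits)
  qed
  moreover have "l = 2"
  proof (rule ccontr)
    assume "l \<noteq> 2"
    thus False using jk_pos[OF deck'(1), of 1] jk calculation by (auto split: if_splits)
  qed
  ultimately show ?thesis by (simp add: as_def bs_def numeral_2_eq_2)
qed

lemma exists_greater_if_same_sum:
  fixes as bs :: "nat list"
  assumes len: "length as = length bs" and sum: "sum_list as = sum_list bs" and neq: "as \<noteq> bs"
  shows "\<exists>j<length as. as ! j > bs ! j"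
proof (rule ccontr)
  let ?l = "length as"
  assume "\<not> ?thesis"
  hence le: "as ! i \<le> bs ! i" if "i < ?l" for i using that by (meson not_less)
  obtain d where d: "d < ?l" "as ! d \<noteq> bs ! d"
    using neq len nth_equalityI by blast
  have "(\<Sum>i<?l. as ! i) < (\<Sum>i<?l. bs ! i)"
  proof (rule sum_strict_mono_ex1)
    have "as ! d < bs ! d" using le[OF d(1)] d(2) by simp
    thus "\<exists>i\<in>{..<?l}. as ! i < bs ! i" using d(1) by blast
  qed (simp_all add: le)
  thus False using sum by (simp add: sum_list_sum_nth len atLeast0LessThan)
qed

text \<open>If \<open>as\<close> and \<open>bs\<close> differ, each exceeds the other somewhere, say \<open>as\<close> at \<open>j\<close> and \<open>bs\<close> at \<open>k\<close>, and
  then all their other entries are 1. The sums agree, so the exceptional entries do too. They equal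
  2: the only full-length entry of the deck of \<open>as\<close> is \<open>as\<close> lowered at \<open>j\<close>, that of \<open>bs\<close> is \<open>bs\<close>
  lowered at \<open>k\<close>, and the latter is 1 at \<open>j\<close>.\<close>

lemma eq_if_same_deck:
  assumes pos: "0 \<notin> set as" "0 \<notin> set bs" and len: "length as = length bs"
    and sum: "sum_list as = sum_list bs"
    and deck: "lowered as ` {..<length as} = lowered bs ` {..<length bs}"
  shows "as = bs \<or> as = [1, 2] \<and> bs = [2, 1] \<or> as = [2, 1] \<and> bs = [1, 2]"
proof (cases "as = bs")
  case False
  let ?l = "length as"
  obtain j where j: "j < ?l" "as ! j > bs ! j"
    using exists_greater_if_same_sum[OF len sum False] by blast
  obtain k where k: "k < ?l" "bs ! k > as ! k"
    using exists_greater_if_same_sum[of bs as] len sum False by metis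
  have jk: "j \<noteq> k" using j k by auto
  have as1: "as ! i = 1" if "i < ?l" "i \<noteq> j" for i
    by (rule others_eq_1_if_greater[OF pos len equalityD1[OF deck] j that])
  have bs1: "bs ! i = 1" if "i < ?l" "i \<noteq> k" for i
    by (rule others_eq_1_if_greater[OF pos(2,1) len[symmetric] equalityD2[OF deck] k[unfolded len]
          that[unfolded len]])
  have as: "as = (replicate ?l 1)[j := as ! j]"
    by (rule nth_equalityI) (use j(1) as1 in \<open>auto simp: nth_list_update\<close>)
  have bs: "bs = (replicate ?l 1)[k := bs ! k]"
    by (rule nth_equalityI) (use k(1) bs1 len in \<open>auto simp: nth_list_update\<close>)
  have "sum_list as = ?l + as ! j - 1"
    using arg_cong[OF as, of sum_list] j(1) by (simp add: sum_list_update sum_list_replicate)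
  moreover have "sum_list bs = ?l + bs ! k - 1"
    using arg_cong[OF bs, of sum_list] k(1) by (simp add: sum_list_update sum_list_replicate)
  ultimately have "?l + as ! j - 1 = ?l + bs ! k - 1"
    using sum by simp
  hence b: "as ! j = bs ! k" using j k by auto
  have bj: "bs ! j = 1" using bs1[OF j(1) jk] .
  hence lj: "lowered as j = as[j := as ! j - 1]"
    using lowered_eq[OF pos(1) j(1)] j(2) by simp
  obtain i where i: "i < length bs" "lowered as j = lowered bs i"
    using deck j(1) by blast
  have "bs ! i \<noteq> 1"
    using arg_cong[OF i(2), of length] length_lowered[OF pos(2) i(1)] i(1) len lj by auto
  hence "i = k" using bs1[of i] i(1) len by auto
  hence "as[j := as ! j - 1] = bs[k := bs ! k - 1]"
    using i(2) lj lowered_eq[OF pos(2) i(1)] \<open>bs ! i \<noteq> 1\<close> by simp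
  hence "as[j := as ! j - 1] ! j = bs[k := bs ! k - 1] ! j" by simp
  hence two: "as ! j = 2" "bs ! k = 2" using j jk bj b by simp_all
  note as = as[unfolded two] and bs = bs[unfolded two]
  show ?thesis
  proof (cases "j < k")
    case True
    thus ?thesis
      using single_2_same_deck[OF _ k(1), of j, folded as bs] deck len by simp
  next
    case False
    hence "k < j" using jk by simp
    thus ?thesis
      using single_2_same_deck[OF _ j(1), of k, folded as bs] deck len by simp
  qed
qed simp

section \<open>Automorphisms permuting the monomial basis\<close>

text \<open>Including the identity makes this class closed under composition, which the
  uniqueness argument needs for \<open>reversal \<circ> \<phi>\<close>.\<close>

definition monomial_automorphism :: "(qsym \<Rightarrow> qsym) \<Rightarrow> bool" where
  "monomial_automorphism \<phi> \<longleftrightarrow> algebra_automorphism \<phi> \<and> graded \<phi> \<and> \<phi> ` range M = range M"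

abbreviation C1 :: composition where "C1 \<equiv> Composition [1]"
abbreviation C12 :: composition where "C12 \<equiv> Composition [1, 2]"
abbreviation C21 :: composition where "C21 \<equiv> Composition [2, 1]"

lemma parts_small [simp]:
  "parts C1 = [1]" "parts C12 = [1, 2]" "parts C21 = [2, 1]"
  by simp_all

lemma C12_neq_C21 [simp]: "C12 \<noteq> C21"
  by (metis list.inject numeral_eq_one_iff parts_small(2,3) semiring_norm(85))

lemma crev_C21: "crev C21 = C12"
  by (simp add: parts_inject[symmetric] crev.rep_eq)

lemma monomial_automorphism_reversal: "monomial_automorphism reversal"
proof -
  \<comment> \<open>A surjective multiplicative map preserves the unit.\<close>
  have "reversal 1 = 1"
    by (metis mult.left_neutral mult.right_neutral reversal_mult reversal_reversal)
  moreover have "bij reversal"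
    by (rule o_bij[of reversal]) (auto simp: fun_eq_iff)
  moreover have "graded reversal"
    unfolding graded_def
  proof (intro allI subsetI)
    fix n f assume "f \<in> reversal ` QSym_deg n"
    then obtain g where g: "f = reversal g" "g \<in> QSym_deg n" by blast
    thus "f \<in> QSym_deg n"
      by (auto simp: mem_QSym_deg_iff qcoeff_reversal crev.rep_eq[symmetric])
  qed
  moreover have "reversal ` range M = range M"
    by (auto simp: reversal_M image_iff) (metis crev_crev)
  ultimately show ?thesis
    by (simp add: monomial_automorphism_def algebra_automorphism_def qlinear_reversal reversal_mult)
qed

lemma monomial_automorphism_comp:
  assumes "monomial_automorphism \<phi>" "monomial_automorphism \<psi>"
  shows "monomial_automorphism (\<phi> \<circ> \<psi>)"
proof -
  have "qlinear (\<phi> \<circ> \<psi>)"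
    using assms by (auto simp: monomial_automorphism_def algebra_automorphism_def
        intro: Vector_Spaces.linear_compose)
  moreover have "graded (\<phi> \<circ> \<psi>)"
    using assms unfolding monomial_automorphism_def graded_def by fastforce
  moreover have "(\<phi> \<circ> \<psi>) ` range M = range M"
    using assms by (simp only: monomial_automorphism_def image_comp[symmetric])
  ultimately show ?thesis
    using assms by (auto simp: monomial_automorphism_def algebra_automorphism_def intro: bij_comp)
qed

lemma permutation_of_monomial_automorphism:
  assumes "monomial_automorphism \<phi>"
  shows "\<exists>\<sigma>. (\<forall>\<alpha>. \<phi> (M \<alpha>) = M (\<sigma> \<alpha>)) \<and> inj \<sigma> \<and> (\<forall>\<alpha>. csize (\<sigma> \<alpha>) = csize \<alpha>)"
proof -
  have "\<forall>\<alpha>. \<exists>\<beta>. \<phi> (M \<alpha>) = M \<beta>"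
    using assms unfolding monomial_automorphism_def by blast
  then obtain \<sigma> where \<sigma>: "\<And>\<alpha>. \<phi> (M \<alpha>) = M (\<sigma> \<alpha>)" by metis
  have "inj \<phi>"
    using assms by (simp add: monomial_automorphism_def algebra_automorphism_def bij_is_inj)
  hence "inj \<sigma>"
    by (metis M_inject \<sigma> injD injI)
  moreover have "csize (\<sigma> \<alpha>) = csize \<alpha>" for \<alpha>
  proof -
    have "M \<alpha> \<in> QSym_deg (csize \<alpha>)" by (simp add: mem_QSym_deg_iff qcoeff_M_parts)
    hence "M (\<sigma> \<alpha>) \<in> QSym_deg (csize \<alpha>)"
      using assms \<sigma> unfolding monomial_automorphism_def graded_def by (metis image_subset_iff)
    thus ?thesis by (simp add: mem_QSym_deg_iff qcoeff_M_parts)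
  qed
  ultimately show ?thesis using \<sigma> by blast
qed

lemma qcoeff_permuted:
  assumes "qlinear \<phi>" "\<And>\<alpha>. \<phi> (M \<alpha>) = M (\<sigma> \<alpha>)" "inj \<sigma>"
  shows "qcoeff (\<phi> f) (parts (\<sigma> \<alpha>)) = qcoeff f (parts \<alpha>)"
proof -
  interpret Vector_Spaces.linear qscale qscale \<phi> by fact
  have "\<phi> f = (\<Sum>\<beta> | qcoeff f (parts \<beta>) \<noteq> 0. qscale (qcoeff f (parts \<beta>)) (M (\<sigma> \<beta>)))"
    by (subst (1) M_expansion[of f]) (simp add: sum scale assms(2))
  thus ?thesis
    using finite_support[of f]
    by (simp add: qcoeff_sum qcoeff_M_parts inj_eq[OF assms(3)] if_distrib cong: if_cong)
qed

lemma eq_C1_if_csize_1: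
  assumes "csize \<alpha> = 1"
  shows "\<alpha> = C1"
proof -
  have "sum_list (parts \<alpha>) = 1" "0 \<notin> set (parts \<alpha>)"
    using assms by (simp_all add: csize.rep_eq)
  hence "parts \<alpha> = [1]"
    by (cases "parts \<alpha>"; cases "tl (parts \<alpha>)") auto
  thus ?thesis by (metis parts_inverse)
qed

text \<open>Applying \<open>\<phi>\<close> to \<open>M C1 * M \<gamma>\<close> for each \<open>\<gamma>\<close> smaller than \<open>\<alpha>\<close> shows that \<open>\<gamma>\<close> has the same
  multiplicity in the decks of \<open>\<alpha>\<close> and \<open>\<sigma> \<alpha>\<close>. The total multiplicity is the number of parts.\<close>

lemma fixes_or_swaps_if_fixes_smaller:
  assumes \<phi>: "monomial_automorphism \<phi>"
    and \<sigma>: "\<And>\<alpha>. \<phi> (M \<alpha>) = M (\<sigma> \<alpha>)" "inj \<sigma>" "\<And>\<alpha>. csize (\<sigma> \<alpha>) = csize \<alpha>"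
    and smaller: "\<And>\<gamma>. csize \<gamma> < csize \<alpha> \<Longrightarrow> \<sigma> \<gamma> = \<gamma>"
  shows "\<sigma> \<alpha> = \<alpha> \<or> \<alpha> = C12 \<and> \<sigma> \<alpha> = C21 \<or> \<alpha> = C21 \<and> \<sigma> \<alpha> = C12"
proof -
  have lin: "qlinear \<phi>" and mult: "\<And>f g. \<phi> (f * g) = \<phi> f * \<phi> g"
    using \<phi> by (simp_all add: monomial_automorphism_def algebra_automorphism_def)
  have "csize (\<sigma> C1) = 1" unfolding \<sigma>(3) by (simp add: csize.rep_eq)
  hence C1: "\<sigma> C1 = C1" by (rule eq_C1_if_csize_1)
  define D where "D \<beta> = image_mset (lowered (parts \<beta>)) (mset_set {..<length (parts \<beta>)})" for \<beta>
  have count: "count (D \<beta>) c = card {i. i < length (parts \<beta>) \<and> lowered (parts \<beta>) i = c}" for \<beta> c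
  proof -
    have "count (D \<beta>) c = card (lowered (parts \<beta>) -` {c} \<inter> {..<length (parts \<beta>)})"
      by (simp add: D_def count_image_mset)
    also have "lowered (parts \<beta>) -` {c} \<inter> {..<length (parts \<beta>)} =
               {i. i < length (parts \<beta>) \<and> lowered (parts \<beta>) i = c}" by auto
    finally show ?thesis .
  qed
  have "D (\<sigma> \<alpha>) = D \<alpha>"
  proof (rule multiset_eqI)
    fix c
    show "count (D (\<sigma> \<alpha>)) c = count (D \<alpha>) c"
      \<comment> \<open>A list that is no smaller composition occurs in neither deck.\<close>
    proof (cases "0 \<notin> set c \<and> sum_list c < csize \<alpha>")
      case True
      define \<gamma> where "\<gamma> = Composition c"
      have c: "c = parts \<gamma>" and "csize \<gamma> < csize \<alpha>"
        using True by (simp_all add: \<gamma>_def csize.rep_eq)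
      hence "\<phi> (M C1 * M \<gamma>) = M C1 * M \<gamma>"
        using smaller[of \<gamma>] by (simp only: mult \<sigma>(1) C1)
      hence "qcoeff (M C1 * M \<gamma>) (parts (\<sigma> \<alpha>)) = qcoeff (M C1 * M \<gamma>) (parts \<alpha>)"
        using qcoeff_permuted[OF lin \<sigma>(1,2), of "M C1 * M \<gamma>" \<alpha>] by simp
      thus ?thesis unfolding qcoeff_M1_mult count c by simp
    next
      case False
      have "count (D \<beta>) c = 0" if "csize \<beta> = csize \<alpha>" for \<beta>
      proof -
        have "lowered (parts \<beta>) i \<noteq> c" if "i < length (parts \<beta>)" for i
          using False sum_lowered[OF zero_notin_parts that] \<open>csize \<beta> = csize \<alpha>\<close>
            zero_notin_strip[of "(parts \<beta>)[i := parts \<beta> ! i - 1]"]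
          by (auto simp: csize.rep_eq lowered_def)
        thus ?thesis by (auto simp: count)
      qed
      thus ?thesis using \<sigma>(3) by simp
    qed
  qed
  hence "size (D (\<sigma> \<alpha>)) = size (D \<alpha>)" "set_mset (D (\<sigma> \<alpha>)) = set_mset (D \<alpha>)" by simp_all
  hence "length (parts (\<sigma> \<alpha>)) = length (parts \<alpha>)"
    "lowered (parts (\<sigma> \<alpha>)) ` {..<length (parts (\<sigma> \<alpha>))} =
     lowered (parts \<alpha>) ` {..<length (parts \<alpha>)}"
    by (simp_all add: D_def)
  hence "parts (\<sigma> \<alpha>) = parts \<alpha> \<or> parts (\<sigma> \<alpha>) = [1, 2] \<and> parts \<alpha> = [2, 1] \<or>
         parts (\<sigma> \<alpha>) = [2, 1] \<and> parts \<alpha> = [1, 2]"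
    by (intro eq_if_same_deck) (use \<sigma>(3) in \<open>auto simp: csize.rep_eq[symmetric]\<close>)
  thus ?thesis
    by (metis parts_inverse)
qed

lemma monomial_automorphism_C12:
  assumes "monomial_automorphism \<phi>"
  shows "\<phi> (M C12) = M C12 \<or> \<phi> (M C12) = M C21"
proof -
  obtain \<sigma> where \<sigma>: "\<And>\<alpha>. \<phi> (M \<alpha>) = M (\<sigma> \<alpha>)" "inj \<sigma>" "\<And>\<alpha>. csize (\<sigma> \<alpha>) = csize \<alpha>"
    using permutation_of_monomial_automorphism[OF assms] by blast
  note step = fixes_or_swaps_if_fixes_smaller[OF assms \<sigma>]
  have three: "csize C12 = 3" "csize C21 = 3" by (simp_all add: csize.rep_eq)
  have "csize \<gamma> < 3 \<Longrightarrow> \<sigma> \<gamma> = \<gamma>" for \<gamma>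
  proof (induction \<gamma> rule: measure_induct_rule[of csize])
    case (less \<gamma>)
    hence "\<sigma> \<gamma> = \<gamma> \<or> \<gamma> = C12 \<and> \<sigma> \<gamma> = C21 \<or> \<gamma> = C21 \<and> \<sigma> \<gamma> = C12"
      by (intro step less.IH) simp_all
    thus ?case using less.prems three by (metis less_irrefl)
  qed
  hence "\<sigma> C12 = C12 \<or> C12 = C12 \<and> \<sigma> C12 = C21 \<or> C12 = C21 \<and> \<sigma> C12 = C12"
    by (intro step) (simp only: three)
  thus ?thesis unfolding \<sigma>(1) by metis
qed

lemma monomial_automorphism_eq_id:
  assumes \<phi>: "monomial_automorphism \<phi>" and fixed: "\<phi> (M C12) = M C12"
  shows "\<phi> = id"
proof -
  obtain \<sigma> where \<sigma>: "\<And>\<alpha>. \<phi> (M \<alpha>) = M (\<sigma> \<alpha>)" "inj \<sigma>" "\<And>\<alpha>. csize (\<sigma> \<alpha>) = csize \<alpha>"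
    using permutation_of_monomial_automorphism[OF \<phi>] by blast
  have C12: "\<sigma> C12 = C12" using fixed unfolding \<sigma>(1) M_inject .
  have "\<sigma> \<alpha> = \<alpha>" for \<alpha>
  proof (induction \<alpha> rule: measure_induct_rule[of csize])
    case (less \<alpha>)
    have "\<sigma> \<alpha> = \<alpha> \<or> \<alpha> = C12 \<and> \<sigma> \<alpha> = C21 \<or> \<alpha> = C21 \<and> \<sigma> \<alpha> = C12"
      by (rule fixes_or_swaps_if_fixes_smaller[OF \<phi> \<sigma> less])
    thus ?case using C12 injD[OF \<sigma>(2), of \<alpha> C12] by metis
  qed
  moreover have "qlinear \<phi>"
    using \<phi> by (simp add: monomial_automorphism_def algebra_automorphism_def)
  ultimately show ?thesis
    using qlinear_eq_if_eq_on_M[of \<phi> id] \<sigma>(1) qsym.linear_id by simp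
qed

theorem proposition4p5:
  shows "(\<exists>!\<rho>. qlinear \<rho> \<and> (\<forall>\<alpha>. \<rho> (F \<alpha>) = F (crev \<alpha>))) \<and>
    (\<forall>\<rho>. qlinear \<rho> \<and> (\<forall>\<alpha>. \<rho> (F \<alpha>) = F (crev \<alpha>)) \<longrightarrow>
       nontrivial_monomial_automorphism \<rho> \<and>
       (\<forall>\<phi>. nontrivial_monomial_automorphism \<phi> \<longrightarrow> \<phi> = \<rho>))"
proof -
  have eq: "\<rho> = reversal" if "qlinear \<rho>" "\<forall>\<alpha>. \<rho> (F \<alpha>) = F (crev \<alpha>)" for \<rho>
  proof (rule qlinear_eq_if_eq_on_F[OF that(1) qlinear_reversal])
    show "\<rho> (F \<alpha>) = reversal (F \<alpha>)" for \<alpha>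
      unfolding reversal_F using that(2) by blast
  qed
  have nontriv: "nontrivial_monomial_automorphism \<phi> \<longleftrightarrow> monomial_automorphism \<phi> \<and> \<phi> \<noteq> id" for \<phi>
    unfolding nontrivial_monomial_automorphism_def monomial_automorphism_def by blast
  have "reversal (M C21) \<noteq> M C21"
    by (simp only: reversal_M crev_C21 M_inject C12_neq_C21 not_False_eq_True)
  hence "reversal \<noteq> id" by auto
  moreover have "\<phi> = reversal" if \<phi>: "monomial_automorphism \<phi>" and "\<phi> \<noteq> id" for \<phi>
  proof -
    have "\<phi> (M C12) = M C21"
      using monomial_automorphism_C12[OF \<phi>] monomial_automorphism_eq_id[OF \<phi>] \<open>\<phi> \<noteq> id\<close> by blast
    hence "(reversal \<circ> \<phi>) (M C12) = M C12"
      by (simp only: o_apply reversal_M crev_C21)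
    hence "reversal \<circ> \<phi> = id"
      by (intro monomial_automorphism_eq_id monomial_automorphism_comp \<phi>
          monomial_automorphism_reversal)
    hence "reversal (\<phi> f) = f" for f by (simp add: fun_eq_iff)
    thus ?thesis by (metis ext reversal_reversal)
  qed
  ultimately have nontriv_iff: "nontrivial_monomial_automorphism \<phi> \<longleftrightarrow> \<phi> = reversal" for \<phi>
    using monomial_automorphism_reversal unfolding nontriv by metis
  have rho_iff: "qlinear \<rho> \<and> (\<forall>\<alpha>. \<rho> (F \<alpha>) = F (crev \<alpha>)) \<longleftrightarrow> \<rho> = reversal" for \<rho>
    using eq[of \<rho>] qlinear_reversal reversal_F by metis
  show ?thesis
    unfolding nontriv_iff rho_iff by blast
qed

end
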